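(* Let $G$ be a finite, simple, connected graph with minimum degree $\geq2$ which is not a cycle graph. Let $t\geq3$ be an integer not larger than the length of a shortest cycle of $G$, and let $\tau=\lfloor t/2\rfloor$. Then $\chi_t(G)=\tau+1$ if and only if $G$ is circularly $t$-partite.
   Context: All graphs are finite, simple and connected. A path of length $t$ is a sequence $v_1,\ldots,v_{t+1}$ of distinct vertices with $v_j\sim v_{j+1}$; its endpoints are $v_1$ and $v_{t+1}$. A cycle of length $\ell\ge 3$ is a sequence of $\ell$ distinct vertices $v_1,\dots,v_\ell$ with $v_j\sim v_{j+1}$ and $v_\ell\sim v_1$. A (not necessarily proper) colouring of the vertices is $t$-periodic if every path of length $t$ has endpoints of the same colour; $\chi_t(G)$ is the largest $k$ such that $G$ has a $t$-periodic colouring of the vertices using exactly $k$ colours. An oriented edge $[v,w]$ is an edge $\{v,w\}$ with input $v$ and output $w$; $\mathcal{O}=\{[v,w],[w,v]: v\sim w\}$. For $k\geq 1$, $G$ is circularly $k$-partite if $\mathcal{O}$ can be partitioned as $\mathcal{O}=\mathcal{O}_1\sqcup\cdots\sqcup\mathcal{O}_k$ with all $\mathcal{O}_j$ non-empty and such that $[v,w]\in\mathcal{O}_j$ implies $[w,z]\in\mathcal{O}_{j+1}$ for every $z\sim w$ with $z\neq v$, indices modulo $k$. *)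

theory Defs
  imports "Graph_Theory.Graph_Theory"
begin

text \<open>
  A finite simple graph is a \<^locale>\<open>pair_graph\<close>: a finite, symmetric, loop-free set \<^term>\<open>parcs G\<close>
  of ordered pairs over \<^term>\<open>pverts G\<close>. Thus \<^term>\<open>parcs G\<close> is the set of oriented edges, where
  \<^term>\<open>(v, w)\<close> has input \<^term>\<open>v\<close> and output \<^term>\<open>w\<close>, and in a \<^locale>\<open>pair_graph\<close>
  the out-degree of a vertex is its degree.
\<close>

definition min_degree :: "'a pair_pre_digraph \<Rightarrow> nat" where
  "min_degree G = Min (out_degree (with_proj G) ` pverts G)"

definition path_of_length :: "'a pair_pre_digraph \<Rightarrow> nat \<Rightarrow> 'a list \<Rightarrow> bool" where
  "path_of_length G t p \<longleftrightarrow> vpath p (with_proj G) \<and> vwalk_length p = t"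

text \<open>A cycle \<open>v\<^sub>1, \<dots>, v\<^sub>l\<close> is listed without repeating its first vertex.\<close>

definition cycle_of_length :: "'a pair_pre_digraph \<Rightarrow> nat \<Rightarrow> 'a list \<Rightarrow> bool" where
  "cycle_of_length G l p \<longleftrightarrow>
     3 \<le> l \<and> length p = l \<and> vpath p (with_proj G) \<and> (last p, hd p) \<in> parcs G"

text \<open>Only meaningful when \<^term>\<open>G\<close> has a cycle, as it does when all degrees are at least two.\<close>

definition girth :: "'a pair_pre_digraph \<Rightarrow> nat" where
  "girth G = (LEAST l. \<exists>p. cycle_of_length G l p)"

text \<open>The second conjunct says that the edges of \<^term>\<open>G\<close> are exactly those of the cycle.\<close>

definition cycle_graph :: "'a pair_pre_digraph \<Rightarrow> bool" where
  "cycle_graph G \<longleftrightarrow>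
     (\<exists>l p. cycle_of_length G l p \<and> pverts G = set p \<and>
        (let A = insert (last p, hd p) (set (vwalk_arcs p)) in parcs G = A \<union> A\<inverse>))"

definition periodic_colouring :: "'a pair_pre_digraph \<Rightarrow> nat \<Rightarrow> ('a \<Rightarrow> nat) \<Rightarrow> bool" where
  "periodic_colouring G t c \<longleftrightarrow> (\<forall>p. path_of_length G t p \<longrightarrow> c (hd p) = c (last p))"

definition chi :: "nat \<Rightarrow> 'a pair_pre_digraph \<Rightarrow> nat" where
  "chi t G = Max {k. \<exists>c. periodic_colouring G t c \<and> card (c ` pverts G) = k}"

text \<open>The classes are indexed by \<open>0, \<dots>, k - 1\<close> instead of \<open>1, \<dots>, k\<close>.\<close>

definition circularly_partite :: "nat \<Rightarrow> 'a pair_pre_digraph \<Rightarrow> bool" where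
  "circularly_partite k G \<longleftrightarrow> 1 \<le> k \<and>
     (\<exists>Os :: nat \<Rightarrow> ('a \<times> 'a) set.
        parcs G = (\<Union>j<k. Os j) \<and>
        disjoint_family_on Os {..<k} \<and>
        (\<forall>j<k. Os j \<noteq> {}) \<and>
        (\<forall>j<k. \<forall>v w z. (v, w) \<in> Os j \<and> (w, z) \<in> parcs G \<and> z \<noteq> v \<longrightarrow>
           (w, z) \<in> Os ((j + 1) mod k)))"

end

theory Submission
  imports Defs "HOL-Number_Theory.Cong"
begin

text \<open>
  As \<open>t\<close> is at most the girth, a non-backtracking walk of length \<open>t\<close> is a path or a closed cycle, so a
  \<open>t\<close>-periodic colouring is exactly one that is \<open>t\<close>-periodic along every bi-infinite non-backtracking walk.
  Two such walks leaving a vertex by different edges can be glued, so their colour sequences are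
  mirror images of each other. Since \<open>G\<close> is not a cycle, some vertex \<open>r\<close> has degree at least three, and
  there the mirroring makes all colour sequences equal to one even, \<open>t\<close>-periodic sequence \<open>x\<close>. By
  connectedness every walk carries a shift of \<open>x\<close>. Hence at most \<open>\<tau> + 1\<close> colours occur, and if all of
  them do, the shift is determined modulo \<open>t\<close> and classifies the oriented edges.

  Conversely, given classes \<open>k [v, w]\<close> modulo \<open>t\<close>, the sum \<open>k [v, w] + k [w, v]\<close> is the same for all edges,
  namely \<open>2 a\<^sub>0 - 1\<close> with \<open>a\<^sub>0\<close> the class of the edges leaving \<open>r\<close>. So \<open>k [v, w] - a\<^sub>0\<close> depends on \<open>v\<close> only
  up to sign, and the orbits of the sign change on the residues modulo \<open>t\<close> serve as \<open>\<tau> + 1\<close> colours.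
\<close>

section \<open>Residues up to sign and periodic sequences\<close>

text \<open>The representative in \<open>{0, \<dots>, t div 2}\<close> of \<open>i\<close> modulo \<open>t\<close> and sign.\<close>

definition refl_mod :: "nat \<Rightarrow> int \<Rightarrow> nat" where
  "refl_mod t i = nat (min (i mod int t) ((- i) mod int t))"

lemma refl_mod_cong: "[i = j] (mod int t) \<Longrightarrow> refl_mod t i = refl_mod t j"
  unfolding refl_mod_def cong_def by (metis mod_minus_eq)

lemma refl_mod_minus [simp]: "refl_mod t (- i) = refl_mod t i"
  by (simp add: refl_mod_def min.commute)

lemma refl_mod_le: "0 < t \<Longrightarrow> refl_mod t i \<le> t div 2"
  by (auto simp: refl_mod_def zmod_zminus1_eq_if min_def)

lemma refl_mod_of_nat: "0 < t \<Longrightarrow> k \<le> t div 2 \<Longrightarrow> refl_mod t (int k) = k"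
  by (auto simp: refl_mod_def zmod_zminus1_eq_if min_def)

lemma refl_mod_cases:
  assumes "0 < t"
  shows "[i = int (refl_mod t i)] (mod int t) \<or> [i = - int (refl_mod t i)] (mod int t)"
proof -
  have "int (refl_mod t i) = i mod int t \<or> int (refl_mod t i) = (- i) mod int t"
    using assms by (auto simp: refl_mod_def min_def)
  then show ?thesis
    by (auto simp: cong_def mod_minus_eq)
qed

lemma periodic_int_multiple:
  fixes f :: "int \<Rightarrow> 'b"
  assumes "\<And>m. f (m + int t) = f m"
  shows "f (m + int t * k) = f m"
proof (induction k rule: int_induct[where k = 0])
  case base
  then show ?case by simp
next
  case (step1 i)
  then show ?case using assms[of "m + int t * i"] by (simp add: algebra_simps)
next
  case (step2 i)
  then show ?case using assms[of "m + int t * (i - 1)"] by (simp add: algebra_simps)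
qed

lemma periodic_int_cong:
  fixes f :: "int \<Rightarrow> 'b"
  assumes "\<And>m. f (m + int t) = f m" and "[i = j] (mod int t)"
  shows "f i = f j"
proof -
  obtain k where "j = i + int t * k"
    using assms(2) by (auto simp: cong_iff_lin)
  then show ?thesis
    using periodic_int_multiple[of f t, OF assms(1)] by simp
qed

text \<open>Every residue class modulo \<open>t\<close> has a non-negative member. This serves to
  compare a glued walk with one of its halves, which it follows only on one side of 0.\<close>

lemma periodic_int_eqI:
  fixes f g :: "int \<Rightarrow> 'b"
  assumes "0 < t" "\<And>m. f (m + int t) = f m" "\<And>m. g (m + int t) = g m"
    and "\<And>m. 0 \<le> m \<Longrightarrow> f m = g m"
  shows "f = g"
proof
  fix m
  have "[m = m mod int t] (mod int t)" by (simp add: cong_def)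
  then have "f m = f (m mod int t)" "g m = g (m mod int t)"
    using periodic_int_cong assms(2,3) by metis+
  then show "f m = g m" using assms(1,4) by simp
qed

lemma set_vwalk_arcs: "set (vwalk_arcs p) = {(p ! i, p ! Suc i) | i. Suc i < length p}"
proof (induction p rule: vwalk_arcs.induct)
  case (3 x y xs)
  show ?case
  proof (intro set_eqI iffI)
    fix e assume "e \<in> set (vwalk_arcs (x # y # xs))"
    then consider "e = (x, y)" | i where "e = ((y # xs) ! i, (y # xs) ! Suc i)" "Suc i < length (y # xs)"
      using 3 by auto
    then show "e \<in> {((x # y # xs) ! i, (x # y # xs) ! Suc i) | i. Suc i < length (x # y # xs)}"
    proof cases
      case 1
      then show ?thesis by (auto intro!: exI[of _ 0])
    next
      case (2 i)
      then show ?thesis by (auto intro!: exI[of _ "Suc i"])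
    qed
  next
    fix e assume "e \<in> {((x # y # xs) ! i, (x # y # xs) ! Suc i) | i. Suc i < length (x # y # xs)}"
    then obtain i where "e = ((x # y # xs) ! i, (x # y # xs) ! Suc i)" "Suc i < length (x # y # xs)"
      by blast
    then show "e \<in> set (vwalk_arcs (x # y # xs))"
      using 3 by (cases i) auto
  qed
qed auto

section \<open>Non-backtracking walks\<close>

text \<open>Only non-negative positions are constrained, but positions are integers so that a
  two-sided walk is itself a ray and \<open>join\<close> can negate positions.\<close>

definition nb_ray :: "'a pair_pre_digraph \<Rightarrow> (int \<Rightarrow> 'a) \<Rightarrow> bool" where
  "nb_ray G w \<longleftrightarrow> (\<forall>i\<ge>0. (w i, w (i + 1)) \<in> parcs G \<and> w (i + 2) \<noteq> w i)"

definition nb_walk :: "'a pair_pre_digraph \<Rightarrow> (int \<Rightarrow> 'a) \<Rightarrow> bool" where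
  "nb_walk G w \<longleftrightarrow> (\<forall>i. (w i, w (i + 1)) \<in> parcs G \<and> w (i + 2) \<noteq> w i)"

definition join :: "(int \<Rightarrow> 'a) \<Rightarrow> (int \<Rightarrow> 'a) \<Rightarrow> int \<Rightarrow> 'a" where
  "join w w' i = (if 0 \<le> i then w i else w' (- i))"

lemma nb_walk_shift: "nb_walk G w \<Longrightarrow> nb_walk G (\<lambda>i. w (i + k))"
  unfolding nb_walk_def by (metis add.assoc add.commute)

lemma nb_walk_ray: "nb_walk G w \<Longrightarrow> nb_ray G w"
  by (simp add: nb_walk_def nb_ray_def)

locale leafless_graph = pair_graph G for G :: "'a pair_pre_digraph" +
  assumes connected: "connected (with_proj G)"
    and min_degree_ge_2: "2 \<le> min_degree G"
begin

lemma arc_sym: "(a, b) \<in> parcs G \<Longrightarrow> (b, a) \<in> parcs G"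
  using arcs_symmetric by blast

lemma arc_irrefl: "(a, a) \<notin> parcs G"
  using pair_no_loops by fastforce

lemma verts_nonempty: "pverts G \<noteq> {}"
  using connected by (auto simp: connected_def strongly_connected_def)

text \<open>Connectedness is reachability in the symmetrised graph, whose arcs are those of
  \<open>G\<close> because \<open>G\<close> is symmetric.\<close>

lemma connected_induct:
  assumes "r \<in> pverts G" "v \<in> pverts G" "P r"
    and "\<And>u v. P u \<Longrightarrow> (u, v) \<in> parcs G \<Longrightarrow> P v"
  shows "P v"
proof -
  have "reachable (mk_symmetric (with_proj G)) r v"
    using connected assms(1,2) by (auto simp: connected_def strongly_connected_def)
  then have "(r, v) \<in> (parcs (mk_symmetric (with_proj G)))\<^sup>*"
    by (auto dest: reachable_rtranclI)
  then show ?thesis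
  proof induction
    case base
    show ?case by (fact assms(3))
  next
    case (step y z)
    then have "(y, z) \<in> parcs G" by (auto simp: mk_symmetric_def intro: arc_sym)
    then show ?case using step assms(4) by blast
  qed
qed

lemma ex_neighbour_neq:
  assumes "v \<in> pverts G"
  shows "\<exists>z. (v, z) \<in> parcs G \<and> z \<noteq> a"
proof (rule ccontr)
  assume "\<not> ?thesis"
  then have "out_arcs (with_proj G) v \<subseteq> {(v, a)}"
    by auto
  then have "card (out_arcs (with_proj G) v) \<le> card {(v, a)}"
    by (intro card_mono) auto
  moreover have "2 \<le> out_degree (with_proj G) v"
    using min_degree_ge_2 assms pair_finite_verts unfolding min_degree_def
    by (meson Min_le dual_order.trans finite_imageI imageI)
  ultimately show False by (simp add: out_degree_def)
qed

text \<open>Degree at least two lets every arc be continued without backtracking; iterating one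
  fixed choice \<open>nx\<close> of continuation gives the ray.\<close>

lemma ex_ray:
  assumes "(a, b) \<in> parcs G"
  shows "\<exists>w. nb_ray G w \<and> w 0 = a \<and> w 1 = b"
proof -
  have "\<forall>e. \<exists>z. e \<in> parcs G \<longrightarrow> (snd e, z) \<in> parcs G \<and> z \<noteq> fst e"
    using ex_neighbour_neq arc_snd_in_verts by blast
  then obtain nx where nx: "\<And>e. e \<in> parcs G \<Longrightarrow> (snd e, nx e) \<in> parcs G \<and> nx e \<noteq> fst e"
    by metis
  define e where "e n = ((\<lambda>e. (snd e, nx e)) ^^ n) (a, b)" for n
  have e0: "e 0 = (a, b)" and eS: "e (Suc n) = (snd (e n), nx (e n))" for n
    by (simp_all add: e_def)
  have eE: "e n \<in> parcs G" for n
    by (induction n) (use assms nx in \<open>auto simp: e0 eS\<close>)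
  have "nb_ray G (\<lambda>i. fst (e (nat i)))"
    unfolding nb_ray_def
  proof (intro allI impI)
    fix i :: int assume "0 \<le> i"
    then have "nat (i + 1) = Suc (nat i)" "nat (i + 2) = Suc (Suc (nat i))" by auto
    then show "(fst (e (nat i)), fst (e (nat (i + 1)))) \<in> parcs G
        \<and> fst (e (nat (i + 2))) \<noteq> fst (e (nat i))"
      using eE[of "nat i"] nx[OF eE[of "nat i"]] by (simp add: eS)
  qed
  then show ?thesis
    by (intro exI[of _ "\<lambda>i. fst (e (nat i))"]) (simp add: e0 eS)
qed

text \<open>The rays leave their common start by different arcs, which is exactly the
  non-backtracking condition at the seam, that is at \<open>i = -1\<close>.\<close>

lemma nb_walk_join:
  assumes "nb_ray G w" "nb_ray G w'" "w 0 = w' 0" "w 1 \<noteq> w' 1"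
  shows "nb_walk G (join w w')"
  unfolding nb_walk_def
proof
  fix i :: int
  have w: "(w j, w (j + 1)) \<in> parcs G" "w (j + 2) \<noteq> w j"
    and w': "(w' j, w' (j + 1)) \<in> parcs G" "w' (j + 2) \<noteq> w' j" if "0 \<le> j" for j
    using assms(1,2) that by (auto simp: nb_ray_def)
  consider "0 \<le> i" | "i = -1" | "i \<le> -2" by linarith
  then show "(join w w' i, join w w' (i + 1)) \<in> parcs G \<and> join w w' (i + 2) \<noteq> join w w' i"
  proof cases
    case 1
    then show ?thesis using w by (simp add: join_def)
  next
    case 2
    then show ?thesis using w'(1)[of 0] assms(3,4) by (simp add: join_def arc_sym)
  next
    case 3
    have "join w w' j = w' (- j)" if "j \<le> 0" for j
      using assms(3) that by (cases "j = 0") (auto simp: join_def)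
    then show ?thesis
      using 3 w'(1)[of "- i - 1"] w'(2)[of "- i - 2"] by (simp add: arc_sym)
  qed
qed

lemma nb_walk_rev: "nb_walk G w \<Longrightarrow> nb_walk G (\<lambda>i. w (k - i))"
  unfolding nb_walk_def
proof
  fix i assume *: "\<forall>i. (w i, w (i + 1)) \<in> parcs G \<and> w (i + 2) \<noteq> w i"
  have "(w (k - i - 1), w (k - i)) \<in> parcs G" "w (k - i) \<noteq> w (k - i - 2)"
    using *[rule_format, of "k - i - 1"] *[rule_format, of "k - i - 2"] by simp_all
  then show "(w (k - i), w (k - (i + 1))) \<in> parcs G \<and> w (k - (i + 2)) \<noteq> w (k - i)"
    by (metis arc_sym diff_diff_eq)
qed

text \<open>A ray through \<open>b\<close> and a ray through another neighbour of \<open>a\<close>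
  are glued at \<open>a\<close>.\<close>

lemma ex_walk:
  assumes "(a, b) \<in> parcs G"
  shows "\<exists>w. nb_walk G w \<and> w 0 = a \<and> w 1 = b"
proof -
  obtain z where z: "(a, z) \<in> parcs G" "z \<noteq> b"
    using ex_neighbour_neq in_arcsD1[OF assms] by blast
  obtain w w' where "nb_ray G w" "w 0 = a" "w 1 = b" "nb_ray G w'" "w' 0 = a" "w' 1 = z"
    using ex_ray[OF assms] ex_ray[OF z(1)] by blast
  then have "nb_walk G (join w w')" "join w w' 0 = a" "join w w' 1 = b"
    using nb_walk_join z(2) by (auto simp: join_def)
  then show ?thesis by blast
qed

lemma walk_in_verts: "nb_walk G w \<Longrightarrow> w i \<in> pverts G"
  unfolding nb_walk_def by (meson in_arcsD1)

section \<open>Paths and cycles inside non-backtracking walks\<close>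

lemma vpath_segment:
  assumes "nb_walk G w" "inj_on w {i..<i + int n}" "0 < n"
  shows "vpath (map (\<lambda>k. w (i + int k)) [0..<n]) (with_proj G)"
proof -
  let ?p = "map (\<lambda>k. w (i + int k)) [0..<n]"
  have "set (vwalk_arcs ?p) \<subseteq> parcs G"
    using assms(1) by (auto simp: set_vwalk_arcs nb_walk_def algebra_simps)
  moreover have "inj_on (\<lambda>k. w (i + int k)) {0..<n}"
  proof (rule inj_onI)
    fix x y assume "x \<in> {0..<n}" "y \<in> {0..<n}" "w (i + int x) = w (i + int y)"
    then have "i + int x = i + int y" by (intro inj_onD[OF assms(2)]) auto
    then show "x = y" by simp
  qed
  then have "distinct ?p" by (simp add: distinct_map)
  ultimately show ?thesis
    using assms walk_in_verts by (auto simp: vpath_def vwalk_def)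
qed

text \<open>A closed stretch of the walk that repeats a vertex contains a strictly shorter closed
  stretch; descending ends at one without repetition, which is a cycle.\<close>

lemma cycle_in_walk:
  assumes "nb_walk G w" "w i = w (i + int n)" "0 < n"
  shows "\<exists>j m. m \<le> n \<and> w j = w (j + int m)
    \<and> cycle_of_length G m (map (\<lambda>k. w (j + int k)) [0..<m])"
  using assms(2,3)
proof (induction n arbitrary: i rule: less_induct)
  case (less n)
  show ?case
  proof (cases "inj_on w {i..<i + int n}")
    case True
    have "(w i, w (i + 1)) \<in> parcs G" "w (i + 2) \<noteq> w i"
      using assms(1) by (auto simp: nb_walk_def)
    \<comment> \<open>Length 1 would be a loop and length 2 a backtracking.\<close>
    then have "n \<noteq> 1" "n \<noteq> 2" using less.prems arc_irrefl by force+
    then have n: "3 \<le> n" using less.prems by simp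
    have "(w (i + int n - 1), w (i + int n)) \<in> parcs G"
      using assms(1)[unfolded nb_walk_def, rule_format, of "i + int n - 1"] by simp
    then have "cycle_of_length G n (map (\<lambda>k. w (i + int k)) [0..<n])"
      using n vpath_segment[OF assms(1) True] less.prems
      by (simp add: cycle_of_length_def last_map hd_map of_nat_diff algebra_simps)
    then show ?thesis using less.prems by blast
  next
    case False
    then obtain a b where "a < b" "w a = w b" "i \<le> a" "b < i + int n"
      by (force simp: inj_on_def linorder_neq_iff)
    then have lt: "nat (b - a) < n" and "w a = w (a + int (nat (b - a)))" "0 < nat (b - a)"
      by auto
    from less.IH[OF this] show ?thesis
      using lt by (meson le_trans less_imp_le)
  qed
qed

text \<open>In a finite graph a walk returns to some vertex, so it contains a cycle. If no vertex
  has three neighbours, the cycle already contains all neighbours of its vertices, and connectedness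
  makes it the whole graph.\<close>

lemma cycle_graph_or_branch:
  "cycle_graph G \<or> (\<exists>r\<in>pverts G. \<forall>a b. \<exists>z. (r, z) \<in> parcs G \<and> z \<noteq> a \<and> z \<noteq> b)"
proof (rule disjCI)
  assume "\<not> (\<exists>r\<in>pverts G. \<forall>a b. \<exists>z. (r, z) \<in> parcs G \<and> z \<noteq> a \<and> z \<noteq> b)"
  then have two: "\<exists>a b. \<forall>z. (r, z) \<in> parcs G \<longrightarrow> z = a \<or> z = b" if "r \<in> pverts G" for r
    using that by blast
  obtain v where "v \<in> pverts G" using verts_nonempty by blast
  then obtain a where "(v, a) \<in> parcs G" using ex_neighbour_neq by blast
  then obtain w where w: "nb_walk G w" using ex_walk by blast
  have "finite (range (\<lambda>k::nat. w (int k)))"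
    using walk_in_verts[OF w] pair_finite_verts by (metis finite_subset image_subsetI)
  then have "\<not> inj (\<lambda>k::nat. w (int k))"
    using finite_imageD infinite_UNIV_nat by blast
  then obtain k l :: nat where "k < l" "w (int k) = w (int l)"
    unfolding inj_def by (metis linorder_neqE_nat)
  then have "w (int k) = w (int k + int (l - k))" "0 < l - k" by simp_all
  then obtain i n where cyc: "cycle_of_length G n (map (\<lambda>k. w (i + int k)) [0..<n])"
    and closed: "w i = w (i + int n)"
    using cycle_in_walk[OF w] by blast
  let ?p = "map (\<lambda>k. w (i + int k)) [0..<n]"
  have n: "3 \<le> n" and dist: "distinct ?p"
    using cyc by (auto simp: cycle_of_length_def vpath_def)
  have inj: "w (i + int a) = w (i + int b) \<Longrightarrow> a < n \<Longrightarrow> b < n \<Longrightarrow> a = b" for a b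
    using dist by (auto simp: distinct_map inj_on_def)
  \<comment> \<open>Winding around the cycle forever makes the two cycle neighbours of \<open>u q\<close> uniformly \<open>u (q \<plusminus> 1)\<close>.\<close>
  define u where "u q = w (i + q mod int n)" for q
  have nat_mod: "nat (q mod int n) < n" for q using n by (simp add: nat_less_iff)
  have u_eq: "u q = u r \<longleftrightarrow> q mod int n = r mod int n" for q r
    using inj[of "nat (q mod int n)" "nat (r mod int n)"] nat_mod[of q] nat_mod[of r] n
    by (auto simp: u_def eq_nat_nat_iff)
  have u_set: "u q \<in> set ?p" for q
    using n nat_mod[of q] by (auto simp: u_def intro!: image_eqI[of _ _ "nat (q mod int n)"])
  have u_arc: "(u q, u (q + 1)) \<in> insert (last ?p, hd ?p) (set (vwalk_arcs ?p))" for q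
  proof (cases "q mod int n = int n - 1")
    case True
    then have "(q + 1) mod int n = 0"
      by (metis add.commute diff_add_cancel mod_add_right_eq mod_self)
    then show ?thesis using True n by (simp add: u_def last_map hd_map of_nat_diff)
  next
    case False
    let ?k = "nat (q mod int n)"
    have "q mod int n < int n" "0 \<le> q mod int n" using n by simp_all
    then have lt: "q mod int n + 1 < int n" using False by linarith
    then have "(q + 1) mod int n = q mod int n + 1"
      using \<open>0 \<le> q mod int n\<close> by (metis add_nonneg_nonneg mod_add_left_eq mod_pos_pos_trivial zero_le_one)
    then have "(u q, u (q + 1)) = (?p ! ?k, ?p ! Suc ?k)" "Suc ?k < length ?p"
      using lt \<open>0 \<le> q mod int n\<close> by (auto simp: u_def nth_append algebra_simps)
    then have "(u q, u (q + 1)) \<in> set (vwalk_arcs ?p)"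
      unfolding set_vwalk_arcs by blast
    then show ?thesis by blast
  qed
  have arcs: "insert (last ?p, hd ?p) (set (vwalk_arcs ?p)) \<subseteq> parcs G"
    using cyc by (auto simp: cycle_of_length_def vpath_def vwalk_def)
  have nbr: "y = u (q - 1) \<or> y = u (q + 1)" if "(u q, y) \<in> parcs G" for q y
  proof -
    \<comment> \<open>Equality would make \<open>n\<close> divide 2. Hence these are two distinct
      neighbours of \<open>u q\<close>, and there is no room for a third.\<close>
    have "u (q - 1) \<noteq> u (q + 1)"
    proof
      assume "u (q - 1) = u (q + 1)"
      then have "int n dvd (q + 1) - (q - 1)" using u_eq mod_eq_dvd_iff by metis
      then show False using n zdvd_imp_le by fastforce
    qed
    moreover have "(u q, u (q + 1)) \<in> parcs G" "(u q, u (q - 1)) \<in> parcs G"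
      using u_arc[of q] u_arc[of "q - 1"] arcs arc_sym by auto
    ultimately show ?thesis using that two[OF in_arcsD1[OF that]] by metis
  qed
  \<comment> \<open>\<open>range u\<close> is closed under taking neighbours.\<close>
  have rng: "v \<in> range u" if "v \<in> pverts G" for v
  proof (rule connected_induct[of "u 0" v])
    show "u 0 \<in> pverts G" using walk_in_verts[OF w] by (simp add: u_def)
    show "b \<in> range u" if "a \<in> range u" "(a, b) \<in> parcs G" for a b
      using that nbr by blast
  qed (use that in auto)
  have "pverts G = set ?p"
    using rng u_set walk_in_verts[OF w] by auto
  moreover have "parcs G = insert (last ?p, hd ?p) (set (vwalk_arcs ?p))
      \<union> (insert (last ?p, hd ?p) (set (vwalk_arcs ?p)))\<inverse>" (is "_ = ?A \<union> ?A\<inverse>")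
  proof
    show "?A \<union> ?A\<inverse> \<subseteq> parcs G" using arcs arc_sym by blast
    show "parcs G \<subseteq> ?A \<union> ?A\<inverse>"
    proof (intro subrelI)
      fix a b assume ab: "(a, b) \<in> parcs G"
      then obtain q where q: "a = u q" using rng in_arcsD1 by blast
      then have "b = u (q - 1) \<or> b = u (q + 1)" using ab nbr by simp
      then show "(a, b) \<in> ?A \<union> ?A\<inverse>"
        using u_arc[of q] u_arc[of "q - 1"] q by auto
    qed
  qed
  ultimately show "cycle_graph G"
    using cyc unfolding cycle_graph_def Let_def by blast
qed

end

section \<open>Colour sequences of periodic colourings\<close>

text \<open>The assumption \<open>branch\<close> expresses that \<open>r\<close> has degree at least
  three: no two vertices exhaust its neighbours, so a neighbour avoiding any two can be
  chosen.\<close>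

locale periodic_coloured_graph = leafless_graph +
  fixes t :: nat and c :: "'a \<Rightarrow> nat" and r :: 'a
  assumes t_ge_3: "3 \<le> t"
    and t_le_girth: "t \<le> girth G"
    and periodic: "periodic_colouring G t c"
    and root_in_verts: "r \<in> pverts G"
    and branch: "\<exists>z. (r, z) \<in> parcs G \<and> z \<noteq> a \<and> z \<noteq> b"
begin

text \<open>If the ends of the segment differ, a repeated vertex in it would close up after fewer
  than \<open>t\<close> steps and yield a cycle shorter than the girth. So the segment is a path of
  length \<open>t\<close>.\<close>

lemma walk_colour_periodic:
  assumes "nb_walk G w"
  shows "c (w (m + int t)) = c (w m)"
proof (cases "w m = w (m + int t)")
  case False
  have "inj_on w {m..<m + int (Suc t)}"
  proof (rule ccontr)
    assume "\<not> ?thesis"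
    then obtain a b where ab: "a < b" "w a = w b" "m \<le> a" "b < m + int (Suc t)"
      by (force simp: inj_on_def linorder_neq_iff)
    then have "a \<noteq> m \<or> b \<noteq> m + int t" using False by auto
    then have lt: "nat (b - a) < t" using ab by linarith
    obtain l p where "l \<le> nat (b - a)" "cycle_of_length G l p"
      using cycle_in_walk[OF assms, of a "nat (b - a)"] ab by auto
    then have "girth G \<le> nat (b - a)"
      unfolding girth_def by (metis (mono_tags, lifting) Least_le dual_order.trans)
    then show False using lt t_le_girth by simp
  qed
  then have "path_of_length G t (map (\<lambda>k. w (m + int k)) [0..<Suc t])"
    using vpath_segment[OF assms] by (simp add: path_of_length_def del: upt_Suc)
  then show ?thesis
    using periodic unfolding periodic_colouring_def
    by (fastforce simp: hd_map last_map simp del: upt_Suc)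
qed simp

text \<open>The glued walk follows \<open>w\<close> to the right of 0 and \<open>w'\<close> reversed
  to the left. All three colour sequences are \<open>t\<close>-periodic, so agreement on one side
  extends to all positions.\<close>

lemma join_colour:
  assumes "nb_walk G w" "nb_walk G w'" "w 0 = w' 0" "w 1 \<noteq> w' 1"
  shows "c (w m) = c (w' (- m))"
proof -
  have t: "0 < t" using t_ge_3 by simp
  have J: "nb_walk G (join w w')"
    using assms nb_walk_join nb_walk_ray by blast
  have rev: "nb_walk G v \<Longrightarrow> nb_walk G (\<lambda>i. v (- i))" for v
    using nb_walk_rev[of v 0] by simp
  have "(\<lambda>m. c (join w w' m)) = (\<lambda>m. c (w m))"
    by (rule periodic_int_eqI[OF t]) (simp_all add: walk_colour_periodic J assms(1), simp add: join_def)
  moreover have "(\<lambda>m. c (join w w' (- m))) = (\<lambda>m. c (w' m))"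
    by (rule periodic_int_eqI[OF t])
      (use walk_colour_periodic[OF rev[OF J]] walk_colour_periodic[OF assms(2)] assms(3) in
        \<open>auto simp: join_def\<close>)
  ultimately show ?thesis by (metis minus_minus)
qed

text \<open>The reversal of \<open>w'\<close> leaves the common start by a different arc, so
  \<open>w\<close> mirrors it; the two reflections cancel.\<close>

lemma walk_colour_determined:
  assumes "nb_walk G w" "nb_walk G w'" "w 0 = w' 0" "w 1 = w' 1"
  shows "c (w m) = c (w' m)"
proof -
  have "w' (- 1 + 2) \<noteq> w' (- 1)" using assms(2) unfolding nb_walk_def by blast
  then show ?thesis
    using join_colour[OF assms(1) nb_walk_rev[OF assms(2), of 0]] assms(3,4) by simp
qed

text \<open>Both \<open>w\<close> and \<open>w'\<close> mirror a walk \<open>x\<close> leaving by a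
  third edge, so they agree. Among \<open>w\<close>, \<open>x\<close>, \<open>y\<close> with
  distinct first edges each mirrors the other two; going round this triangle composes three
  reflections, which forces evenness.\<close>

lemma root_walk_colour:
  assumes "nb_walk G w" "nb_walk G w'" "w 0 = r" "w' 0 = r"
  shows "c (w m) = c (w' m)" and "c (w (- m)) = c (w m)"
proof -
  obtain a where "(r, a) \<in> parcs G" "a \<noteq> w 1" "a \<noteq> w' 1" using branch by blast
  then obtain x where x: "nb_walk G x" "x 0 = r" "x 1 \<noteq> w 1" "x 1 \<noteq> w' 1"
    using ex_walk by metis
  obtain b where "(r, b) \<in> parcs G" "b \<noteq> w 1" "b \<noteq> x 1" using branch by blast
  then obtain y where y: "nb_walk G y" "y 0 = r" "y 1 \<noteq> w 1" "y 1 \<noteq> x 1"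
    using ex_walk by metis
  have "c (w m) = c (x (- m))" for m using join_colour[of w x m] assms x by auto
  moreover have "c (w' m) = c (x (- m))" using join_colour[of w' x m] assms x by auto
  moreover have "c (w m) = c (y (- m))" for m using join_colour[of w y m] assms y by auto
  moreover have "c (x m) = c (y (- m))" for m using join_colour[of x y m] x y by auto
  ultimately show "c (w m) = c (w' m)" "c (w (- m)) = c (w m)" by (metis minus_minus)+
qed

section \<open>The common colour pattern at the branch vertex\<close>

definition root_walk :: "int \<Rightarrow> 'a" where
  "root_walk = (SOME w. nb_walk G w \<and> w 0 = r)"

lemma root_walk: "nb_walk G root_walk" "root_walk 0 = r"
proof -
  have "\<exists>w. nb_walk G w \<and> w 0 = r" using branch ex_walk by metis
  then show "nb_walk G root_walk" "root_walk 0 = r"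
    unfolding root_walk_def by (metis (mono_tags, lifting) someI)+
qed

text \<open>By \<open>root_walk_colour\<close> the choice of walk from \<open>r\<close> does not
  matter.\<close>

definition pattern :: "int \<Rightarrow> nat" where
  "pattern m = c (root_walk m)"

lemma pattern_minus: "pattern (- m) = pattern m"
  using root_walk_colour(2) root_walk by (simp add: pattern_def)

lemma pattern_periodic: "pattern (m + int t) = pattern m"
  using walk_colour_periodic root_walk by (simp add: pattern_def)

lemma pattern_cong: "[i = j] (mod int t) \<Longrightarrow> pattern i = pattern j"
  using periodic_int_cong[of pattern] pattern_periodic by blast

lemma pattern_refl_mod: "pattern m = pattern (int (refl_mod t m))"
  using refl_mod_cases[of t m] t_ge_3 pattern_cong pattern_minus by fastforce

text \<open>The property spreads along arcs. A walk from the new vertex back to the old one is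
  reversed, any other walk from the new vertex mirrors such a walk, and evenness of
  \<open>pattern\<close> turns a reflected shift into a shift.\<close>

lemma walk_colour_eq_pattern:
  assumes "nb_walk G w"
  shows "\<exists>j. \<forall>m. c (w m) = pattern (m + j)"
proof -
  have "\<forall>w. nb_walk G w \<and> w 0 = v \<longrightarrow> (\<exists>j. \<forall>m. c (w m) = pattern (m + j))" if "v \<in> pverts G" for v
  proof (rule connected_induct[OF root_in_verts that])
    show "\<forall>w. nb_walk G w \<and> w 0 = r \<longrightarrow> (\<exists>j. \<forall>m. c (w m) = pattern (m + j))"
      using root_walk root_walk_colour(1) unfolding pattern_def by (metis add.right_neutral)
  next
    fix v u
    assume IH: "\<forall>w. nb_walk G w \<and> w 0 = v \<longrightarrow> (\<exists>j. \<forall>m. c (w m) = pattern (m + j))"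
      and vu: "(v, u) \<in> parcs G"
    have backward: "\<exists>j. \<forall>m. c (w m) = pattern (m + j)" if w: "nb_walk G w" "w 0 = u" "w 1 = v" for w
    proof -
      \<comment> \<open>The walk \<open>w (1 - i)\<close> starts at \<open>v\<close>. Since
        \<open>(1 - m) + j\<close> is the negative of \<open>m + (- 1 - j)\<close>, evenness gives
        the shift for \<open>w\<close>.\<close>
      obtain j where j: "\<And>m. c (w (1 - m)) = pattern (m + j)"
        using IH[rule_format, of "\<lambda>i. w (1 - i)"] nb_walk_rev[OF w(1)] w(3) by auto
      have "c (w m) = pattern (m + (- 1 - j))" for m
        using j[of "1 - m"] pattern_minus[of "1 - m + j"] by (simp add: algebra_simps)
      then show ?thesis by blast
    qed
    show "\<forall>w. nb_walk G w \<and> w 0 = u \<longrightarrow> (\<exists>j. \<forall>m. c (w m) = pattern (m + j))"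
    proof (intro allI impI)
      fix w assume w: "nb_walk G w \<and> w 0 = u"
      show "\<exists>j. \<forall>m. c (w m) = pattern (m + j)"
      proof (cases "w 1 = v")
        case True
        then show ?thesis using backward w by blast
      next
        case False
        obtain z where z: "nb_walk G z" "z 0 = u" "z 1 = v"
          using ex_walk arc_sym[OF vu] by blast
        then obtain j where j: "\<And>m. c (z m) = pattern (m + j)" using backward by blast
        have "c (w m) = pattern (m + (- j))" for m
          using join_colour[of w z m] w z False j pattern_minus[of "- m + j"] by auto
        then show ?thesis by blast
      qed
    qed
  qed
  then show ?thesis using assms walk_in_verts by blast
qed

section \<open>Number of colours and the extremal case\<close>

lemma colours_subset: "c ` pverts G \<subseteq> (\<lambda>k. pattern (int k)) ` {..t div 2}"
proof
  fix y assume "y \<in> c ` pverts G"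
  then obtain v where v: "v \<in> pverts G" "y = c v" by blast
  then obtain w where "nb_walk G w" "w 0 = v"
    using ex_neighbour_neq ex_walk by metis
  then obtain j where "y = pattern j"
    using walk_colour_eq_pattern v(2) by (metis add_0)
  then show "y \<in> (\<lambda>k. pattern (int k)) ` {..t div 2}"
    using pattern_refl_mod[of j] refl_mod_le[of t j] t_ge_3 by auto
qed

lemma card_colours_le: "card (c ` pverts G) \<le> t div 2 + 1"
proof -
  have "card (c ` pverts G) \<le> card ((\<lambda>k. pattern (int k)) ` {..t div 2})"
    by (intro card_mono colours_subset) auto
  also have "\<dots> \<le> card {..t div 2}" by (rule card_image_le) auto
  finally show ?thesis by simp
qed

text \<open>This many colours force \<open>pattern\<close> to be injective on
  \<open>0, ..., t div 2\<close>. Then only multiples of \<open>t\<close> share the colour of 0, so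
  shifts are determined modulo \<open>t\<close>, and an arc is classified by the shift of the walks
  starting with it.\<close>

lemma circularly_partite_if_card_eq:
  assumes "card (c ` pverts G) = t div 2 + 1"
  shows "circularly_partite t G"
proof -
  have t: "0 < t" using t_ge_3 by simp
  have "card ((\<lambda>k. pattern (int k)) ` {..t div 2}) = card {..t div 2}"
    using card_mono[OF _ colours_subset] card_image_le[of "{..t div 2}" "\<lambda>k. pattern (int k)"] assms
    by simp
  then have inj: "inj_on (\<lambda>k. pattern (int k)) {..t div 2}"
    by (intro eq_card_imp_inj_on) auto
  have zero: "[i = 0] (mod int t)" if "pattern i = pattern 0" for i
  proof -
    have "refl_mod t i = 0"
      using inj_onD[OF inj, of "refl_mod t i" 0] that pattern_refl_mod[of i] refl_mod_le[OF t] by simp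
    then show ?thesis using refl_mod_cases[OF t, of i] by simp
  qed
  have uniq: "j = k" if "\<And>m. pattern (m + int j) = pattern (m + int k)" "j < t" "k < t" for j k
  proof -
    \<comment> \<open>At position \<open>- int j\<close> the two shifts read
      \<open>pattern 0\<close> and \<open>pattern (int k - int j)\<close>.\<close>
    have "[int k - int j = 0] (mod int t)"
      using that(1)[of "- int j"] by (intro zero) simp
    then have "[int k = int j] (mod int t)" by (simp add: cong_diff_iff_cong_0)
    then show ?thesis using that(2,3) by (simp add: cong_int_iff cong_def)
  qed
  \<comment> \<open>One witness walk suffices: by \<open>walk_colour_determined\<close> all walks
    with the same first arc have the same colours.\<close>
  define Os where "Os j = {(a, b). (a, b) \<in> parcs G \<and>
    (\<exists>w. nb_walk G w \<and> w 0 = a \<and> w 1 = b \<and> (\<forall>m. c (w m) = pattern (m + int j)))}" for j :: nat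
  have "parcs G \<subseteq> (\<Union>j<t. Os j)"
  proof (intro subrelI)
    fix a b assume ab: "(a, b) \<in> parcs G"
    then obtain w where w: "nb_walk G w" "w 0 = a" "w 1 = b" using ex_walk by blast
    then obtain j where j: "\<And>m. c (w m) = pattern (m + j)" using walk_colour_eq_pattern by blast
    have "c (w m) = pattern (m + int (nat (j mod int t)))" for m
      unfolding j using t by (intro pattern_cong) (simp add: cong_def mod_add_right_eq)
    then have "(a, b) \<in> Os (nat (j mod int t))" using ab w by (auto simp: Os_def)
    moreover have "nat (j mod int t) < t" using t by (simp add: nat_less_iff)
    ultimately show "(a, b) \<in> (\<Union>j<t. Os j)" by blast
  qed
  then have "parcs G = (\<Union>j<t. Os j)" by (auto simp: Os_def)
  moreover have "disjoint_family_on Os {..<t}"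
  proof (unfold disjoint_family_on_def, intro ballI impI)
    fix j k assume jk: "j \<in> {..<t}" "k \<in> {..<t}" "j \<noteq> k"
    show "Os j \<inter> Os k = {}"
    proof (rule ccontr)
      assume "Os j \<inter> Os k \<noteq> {}"
      then obtain w w' where "nb_walk G w" "nb_walk G w'" "w 0 = w' 0" "w 1 = w' 1"
        "\<And>m. c (w m) = pattern (m + int j)" "\<And>m. c (w' m) = pattern (m + int k)"
        by (fastforce simp: Os_def)
      then have "pattern (m + int j) = pattern (m + int k)" for m
        using walk_colour_determined by metis
      then show False using uniq jk by blast
    qed
  qed
  moreover have "Os j \<noteq> {}" for j
  proof -
    have "(root_walk (int j), root_walk (int j + 1)) \<in> Os j"
      unfolding Os_def using root_walk(1) nb_walk_shift[OF root_walk(1), of "int j"]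
      by (auto simp: nb_walk_def pattern_def add.commute intro!: exI[of _ "\<lambda>i. root_walk (i + int j)"])
    then show ?thesis by blast
  qed
  moreover have "(w, z) \<in> Os ((j + 1) mod t)"
    if vw: "(v, w) \<in> Os j" and wz: "(w, z) \<in> parcs G" "z \<noteq> v" for j v w z
  proof -
    obtain x where x: "nb_walk G x" "x 0 = v" "x 1 = w" "\<And>m. c (x m) = pattern (m + int j)"
      using vw by (auto simp: Os_def)
    obtain y where y: "nb_walk G y" "y 0 = w" "y 1 = z" using ex_walk[OF wz(1)] by blast
    \<comment> \<open>Reversing \<open>x\<close> about its first arc gives a walk from
      \<open>w\<close> to \<open>v\<close>; as \<open>z\<close> differs from \<open>v\<close>, it is
      mirrored by \<open>y\<close>.\<close>
    have "c (y m) = c (x (m + 1))" for m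
      using join_colour[OF y(1) nb_walk_rev[OF x(1), of 1]] x y wz(2) by (simp add: add.commute)
    also have "c (x (m + 1)) = pattern (m + int ((j + 1) mod t))" for m
      unfolding x(4) by (intro pattern_cong) (simp add: cong_def mod_add_right_eq zmod_int algebra_simps)
    finally show ?thesis using y wz by (auto simp: Os_def)
  qed
  ultimately show ?thesis
    unfolding circularly_partite_def using t by (intro conjI exI[of _ Os]) (simp_all, blast)
qed

end

section \<open>Colourings from circular partitions\<close>

context leafless_graph
begin

text \<open>Classes grow by one per arc, so they return after \<open>t\<close> arcs. Once centred at
  \<open>a0\<close>, changing the outgoing arc at a vertex at most flips the sign, which
  \<open>refl_mod\<close> forgets.\<close>

lemma ex_colouring_if_circularly_partite:
  assumes t: "3 \<le> t" and part: "circularly_partite t G"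
    and root: "r \<in> pverts G" and branch: "\<And>a b. \<exists>z. (r, z) \<in> parcs G \<and> z \<noteq> a \<and> z \<noteq> b"
  shows "\<exists>c. periodic_colouring G t c \<and> card (c ` pverts G) = t div 2 + 1"
proof -
  obtain Os :: "nat \<Rightarrow> ('a \<times> 'a) set" where un: "parcs G = (\<Union>j<t. Os j)"
    and disj: "disjoint_family_on Os {..<t}" and ne: "\<And>j. j < t \<Longrightarrow> Os j \<noteq> {}"
    and nxt: "\<And>j v w z. j < t \<Longrightarrow> (v, w) \<in> Os j \<Longrightarrow> (w, z) \<in> parcs G \<Longrightarrow> z \<noteq> v
      \<Longrightarrow> (w, z) \<in> Os ((j + 1) mod t)"
    using part[unfolded circularly_partite_def] by (elim conjE exE) metis
  have t0: "0 < t" using t by simp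
  have "\<forall>e\<in>parcs G. \<exists>j. j < t \<and> e \<in> Os j" using un by blast
  then obtain cl where cl: "\<And>e. e \<in> parcs G \<Longrightarrow> cl e < t \<and> e \<in> Os (cl e)" by metis
  have clI: "cl e = j" if "e \<in> Os j" "j < t" for e j
    using that cl[of e] un disj unfolding disjoint_family_on_def by blast
  define k where "k a b = int (cl (a, b))" for a b
  have step: "[k b z = k a b + 1] (mod int t)"
    if "(a, b) \<in> parcs G" "(b, z) \<in> parcs G" "z \<noteq> a" for a b z
  proof -
    have "(b, z) \<in> Os ((cl (a, b) + 1) mod t)" using nxt cl that by blast
    then have "cl (b, z) = (cl (a, b) + 1) mod t" using clI t0 by simp
    then show ?thesis by (simp add: k_def cong_def zmod_int add.commute)
  qed
  obtain x0 where x0: "(r, x0) \<in> parcs G" using branch by blast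
  define a0 where "a0 = k r x0"
  have sum: "[k a b + k b a = 2 * a0 - 1] (mod int t)" if "(a, b) \<in> parcs G" for a b
  proof -
    have "\<forall>b. (a, b) \<in> parcs G \<longrightarrow> [k a b + k b a = 2 * a0 - 1] (mod int t)"
    proof (rule connected_induct[OF root in_arcsD1[OF that]], intro allI impI)
      fix x assume x: "(r, x) \<in> parcs G"
      \<comment> \<open>A third neighbour \<open>z\<close> precedes both arcs, so each has class
        \<open>k z r + 1\<close>.\<close>
      have eq: "[k r x = k r y] (mod int t)" if "(r, x) \<in> parcs G" "(r, y) \<in> parcs G" for x y
      proof -
        obtain z where "(r, z) \<in> parcs G" "z \<noteq> x" "z \<noteq> y" using branch by blast
        then have "[k r x = k z r + 1] (mod int t)" "[k r y = k z r + 1] (mod int t)"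
          using step arc_sym that by auto
        then show ?thesis using cong_sym cong_trans by blast
      qed
      obtain y where y: "(r, y) \<in> parcs G" "y \<noteq> x" using branch by blast
      have "[k r x = a0] (mod int t)" "[k r y = a0] (mod int t)"
        using eq x0 x y unfolding a0_def by blast+
      moreover have "[k r y = k x r + 1] (mod int t)" using step arc_sym x y by blast
      ultimately have "[k r x + (k x r + 1) - 1 = a0 + a0 - 1] (mod int t)"
        by (meson cong_add cong_diff cong_refl cong_sym cong_trans)
      then show "[k r x + k x r = 2 * a0 - 1] (mod int t)" by simp
    next
      fix v u assume IH: "\<forall>b. (v, b) \<in> parcs G \<longrightarrow> [k v b + k b v = 2 * a0 - 1] (mod int t)"
        and vu: "(v, u) \<in> parcs G"
      show "\<forall>b. (u, b) \<in> parcs G \<longrightarrow> [k u b + k b u = 2 * a0 - 1] (mod int t)"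
      proof (intro allI impI)
        fix b assume ub: "(u, b) \<in> parcs G"
        show "[k u b + k b u = 2 * a0 - 1] (mod int t)"
        proof (cases "b = v")
          case True
          then show ?thesis using IH vu by (simp add: add.commute)
        next
          case False
          \<comment> \<open>Moving on from \<open>(v, u)\<close> to \<open>(u, b)\<close> raises the
            class by one, while the class of the reversed arc drops by one, so the sum is
            kept.\<close>
          have "[k u b = k v u + 1] (mod int t)" using step vu ub False by blast
          moreover have "[k b u + 1 = k u v] (mod int t)"
            using step[OF arc_sym[OF ub] arc_sym[OF vu]] False cong_sym by blast
          ultimately have "[k u b + (k b u + 1) - 1 = k v u + 1 + k u v - 1] (mod int t)"
            by (intro cong_diff cong_add cong_refl)
          then show ?thesis using IH vu by (auto intro: cong_trans)
        qed
      qed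
    qed
    then show ?thesis using that by blast
  qed
  have "\<forall>v. \<exists>z. v \<in> pverts G \<longrightarrow> (v, z) \<in> parcs G" using ex_neighbour_neq by blast
  then obtain nb where nb: "\<And>v. v \<in> pverts G \<Longrightarrow> (v, nb v) \<in> parcs G" by metis
  define c where "c v = refl_mod t (k v (nb v) - a0)" for v
  have c_eq: "c v = refl_mod t (k v b - a0)" if vb: "(v, b) \<in> parcs G" for v b
  proof (cases "b = nb v")
    case False
    have vn: "(v, nb v) \<in> parcs G" using nb in_arcsD1 vb by blast
    have "[k v b = k (nb v) v + 1] (mod int t)" using step arc_sym vn vb False by blast
    then have "[k v b - a0 = k (nb v) v + 1 - a0] (mod int t)" by (intro cong_diff cong_refl)
    \<comment> \<open>This isolates the constant sum over the edge joining \<open>v\<close> and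
      \<open>nb v\<close>.\<close>
    also have "k (nb v) v + 1 - a0 = (k v (nb v) + k (nb v) v) - (k v (nb v) + a0 - 1)" by simp
    also have "[\<dots> = (2 * a0 - 1) - (k v (nb v) + a0 - 1)] (mod int t)"
      by (intro cong_diff cong_refl sum vn)
    also have "(2 * a0 - 1) - (k v (nb v) + a0 - 1) = - (k v (nb v) - a0)" by simp
    finally show ?thesis unfolding c_def by (metis refl_mod_cong refl_mod_minus)
  qed (simp add: c_def)
  have "periodic_colouring G t c"
    unfolding periodic_colouring_def
  proof (intro allI impI)
    fix p assume "path_of_length G t p"
    then have dist: "distinct p" and len: "length p = Suc t"
      and "{(p ! i, p ! Suc i) | i. Suc i < length p} \<subseteq> parcs G"
      using t by (auto simp: path_of_length_def vpath_def vwalk_def set_vwalk_arcs)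
    then have arc: "(p ! i, p ! Suc i) \<in> parcs G" if "i < t" for i
      using that by auto
    have k: "[k (p ! i) (p ! Suc i) = k (p ! 0) (p ! 1) + int i] (mod int t)" if "i < t" for i
      using that
    proof (induction i)
      case (Suc i)
      have "p ! Suc (Suc i) \<noteq> p ! i" using dist len Suc.prems by (simp add: nth_eq_iff_index_eq)
      then have "[k (p ! Suc i) (p ! Suc (Suc i)) = k (p ! i) (p ! Suc i) + 1] (mod int t)"
        using step arc Suc.prems by simp
      also have "[k (p ! i) (p ! Suc i) + 1 = k (p ! 0) (p ! 1) + int i + 1] (mod int t)"
        using Suc by (intro cong_add cong_refl) simp
      finally show ?case by (simp add: algebra_simps)
    qed simp
    have la: "(p ! (t - 1), p ! t) \<in> parcs G" using arc[of "t - 1"] t0 by simp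
    \<comment> \<open>The last arc of the path enters \<open>p ! t\<close>, but colours are read off
      outgoing arcs. Continuing to \<open>z\<close> gives an arc \<open>t\<close> steps after the
      first one, hence of the same class.\<close>
    then obtain z where z: "(p ! t, z) \<in> parcs G" "z \<noteq> p ! (t - 1)"
      using ex_neighbour_neq in_arcsD2 by blast
    have "[k (p ! t) z = k (p ! (t - 1)) (p ! t) + 1] (mod int t)" using step la z by blast
    also have "[k (p ! (t - 1)) (p ! t) + 1 = k (p ! 0) (p ! 1) + int (t - 1) + 1] (mod int t)"
      using k[of "t - 1"] t0 by (intro cong_add cong_refl) simp
    also have "k (p ! 0) (p ! 1) + int (t - 1) + 1 = k (p ! 0) (p ! 1) + int t"
      using t0 by (simp add: of_nat_diff)
    also have "[\<dots> = k (p ! 0) (p ! 1)] (mod int t)" by (simp add: cong_def)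
    finally have "[k (p ! t) z - a0 = k (p ! 0) (p ! 1) - a0] (mod int t)"
      by (intro cong_diff cong_refl)
    then have "c (p ! t) = c (p ! 0)"
      using c_eq[OF z(1)] c_eq[OF arc[of 0]] t0 refl_mod_cong by simp
    moreover have "hd p = p ! 0" "last p = p ! t"
      using len by (auto simp: hd_conv_nth last_conv_nth simp flip: length_greater_0_conv)
    ultimately show "c (hd p) = c (last p)" by simp
  qed
  moreover have "c ` pverts G = {..t div 2}"
  proof
    show "c ` pverts G \<subseteq> {..t div 2}" using refl_mod_le[OF t0] by (auto simp: c_def)
    show "{..t div 2} \<subseteq> c ` pverts G"
    proof
      fix j assume j: "j \<in> {..t div 2}"
      \<comment> \<open>Arcs of class \<open>a0 + j\<close> have centred class \<open>j\<close>; as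
        this class is inhabited, the input of such an arc has colour \<open>j\<close>.\<close>
      define i where "i = nat ((a0 + int j) mod int t)"
      have i: "i < t" using t0 by (simp add: i_def nat_less_iff)
      then obtain a b where ab: "(a, b) \<in> Os i" using ne by fastforce
      then have "k a b = (a0 + int j) mod int t" using clI[OF ab i] t0 by (simp add: k_def i_def)
      then have "[k a b - a0 = int j] (mod int t)" by (simp add: cong_def mod_diff_left_eq)
      moreover have E: "(a, b) \<in> parcs G" using ab i un by blast
      ultimately have "c a = j"
        using c_eq[OF E] refl_mod_of_nat[OF t0] j refl_mod_cong by force
      then show "j \<in> c ` pverts G" using in_arcsD1[OF E] by blast
    qed
  qed
  ultimately show ?thesis by (intro exI[of _ c]) simp
qed

end

theorem theorem5p2:
  fixes G :: "'a pair_pre_digraph" and t :: nat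
  assumes "pair_graph G"
    and "connected (with_proj G)"
    and "min_degree G \<ge> 2"
    and "\<not> cycle_graph G"
    and "3 \<le> t"
    and "t \<le> girth G"
  shows "chi t G = t div 2 + 1 \<longleftrightarrow> circularly_partite t G"
proof -
  interpret pair_graph G by fact
  interpret leafless_graph G using assms(2,3) by unfold_locales
  obtain r where r: "r \<in> pverts G" "\<And>a b. \<exists>z. (r, z) \<in> parcs G \<and> z \<noteq> a \<and> z \<noteq> b"
    using cycle_graph_or_branch assms(4) by blast
  let ?K = "{k. \<exists>c. periodic_colouring G t c \<and> card (c ` pverts G) = k}"
  have loc: "periodic_coloured_graph G t c r" if "periodic_colouring G t c" for c
    using that assms r by unfold_locales auto
  have le: "k \<le> t div 2 + 1" if "k \<in> ?K" for k
    using that periodic_coloured_graph.card_colours_le[OF loc] by blast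
  then have fin: "finite ?K" by (meson finite_nat_set_iff_bounded_le)
  \<comment> \<open>The constant colouring makes \<open>?K\<close> non-empty; with finiteness,
    \<open>Max\<close> is then attained.\<close>
  have "periodic_colouring G t (\<lambda>_. 0)" by (simp add: periodic_colouring_def)
  then have ne: "?K \<noteq> {}" by blast
  show ?thesis
  proof
    assume "chi t G = t div 2 + 1"
    then have "t div 2 + 1 \<in> ?K" using Max_in[OF fin ne] by (simp add: chi_def)
    then show "circularly_partite t G"
      using periodic_coloured_graph.circularly_partite_if_card_eq[OF loc] by blast
  next
    assume "circularly_partite t G"
    then have "t div 2 + 1 \<in> ?K"
      using ex_colouring_if_circularly_partite assms(5) r by blast
    then show "chi t G = t div 2 + 1"
      unfolding chi_def using fin le by (intro Max_eqI) auto
  qed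
qed

end
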